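(* Let $K$ be a connected graph with $V$ vertices and $E$ edges. Then the number of symmetric $1$-cycles in $K^{\square 2}$ equals $2^{VE-\binom{V}{2}}$.
   Context: A graph is a finite simple graph. A $1$-cycle in a graph is a set of edges (possibly empty) such that every vertex belongs to an even number of edges of the set. The graph $K^{\square 2}=K\mathbin{\square}K$ is defined as follows: its vertices are the ordered pairs $(a,b)$ of vertices of $K$, denoted $a\mathbin{\square}b$; whenever $bc$ is an edge of $K$ and $a$ is a vertex of $K$, the vertices $a\mathbin{\square}b$ and $a\mathbin{\square}c$ are joined by an edge, and the vertices $b\mathbin{\square}a$ and $c\mathbin{\square}a$ are joined by an edge; there are no other edges. A $1$-cycle in $K^{\square 2}$ is symmetric if it is mapped to itself by the involution of $K^{\square2}$ exchanging the factors, $a\mathbin{\square}b\mapsto b\mathbin{\square}a$. *)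

theory Defs
  imports Complex_Main
begin

definition simple_graph :: "'a set \<Rightarrow> 'a set set \<Rightarrow> bool" where
  "simple_graph V E \<longleftrightarrow> finite V \<and> (\<forall>e\<in>E. e \<subseteq> V \<and> card e = 2)"

(* The graph with no vertices counts as connected. *)
definition connected_graph :: "'a set \<Rightarrow> 'a set set \<Rightarrow> bool" where
  "connected_graph V E \<longleftrightarrow> (\<forall>u\<in>V. \<forall>v\<in>V. (u, v) \<in> {(x, y). {x, y} \<in> E}\<^sup>*)"

definition one_cycle :: "'a set \<Rightarrow> 'a set set \<Rightarrow> 'a set set \<Rightarrow> bool" where
  "one_cycle V E C \<longleftrightarrow> C \<subseteq> E \<and> (\<forall>v\<in>V. even (card {e \<in> C. v \<in> e}))"

definition box_square_verts :: "'a set \<Rightarrow> ('a \<times> 'a) set" where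
  "box_square_verts V = V \<times> V"

definition box_square_edges :: "'a set \<Rightarrow> 'a set set \<Rightarrow> ('a \<times> 'a) set set" where
  "box_square_edges V E =
     {{(a, b), (a, c)} | a b c. a \<in> V \<and> {b, c} \<in> E} \<union>
     {{(b, a), (c, a)} | a b c. a \<in> V \<and> {b, c} \<in> E}"

lemma simple_graph_box_square:
  assumes "simple_graph V E"
  shows "simple_graph (box_square_verts V) (box_square_edges V E)"
proof -
  have edge: "b \<in> V \<and> c \<in> V \<and> b \<noteq> c" if "{b, c} \<in> E" for b c
  proof -
    have "{b, c} \<subseteq> V" "card {b, c} = 2"
      using assms that unfolding simple_graph_def by blast+
    then show ?thesis by (auto split: if_splits)
  qed
  show ?thesis
    using assms edge
    unfolding simple_graph_def box_square_verts_def box_square_edges_def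
    by (fastforce simp: card_2_iff)
qed

(* prod.swap acts on edges, i.e. on two-element sets of vertices, by taking images. *)
definition swap_invariant :: "('a \<times> 'a) set set \<Rightarrow> bool" where
  "swap_invariant C \<longleftrightarrow> (\<lambda>e. prod.swap ` e) ` C = C"

end

theory Submission
  imports Defs
begin

text \<open>
  A swap-invariant edge set of the square is determined by the set \<open>S \<subseteq> V \<times> E\<close> of the pairs \<open>(a, e)\<close>
  for which it contains \<open>{a} \<times> e\<close>. Its degree at \<open>(a, b)\<close> is symmetric in \<open>a\<close> and \<open>b\<close> and is
  even for \<open>a = b\<close>, so being a cycle amounts to one parity condition for each two-element
  subset of \<open>V\<close>. These conditions are linear over the field with two elements, and they are
  independent: if \<open>P\<close> is the edge set of a path from \<open>b\<close> to \<open>a\<close>, then \<open>S = {a} \<times> P\<close>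
  violates the condition at \<open>{a, b}\<close> and no other.
\<close>

section \<open>Linear algebra modulo 2 and boundaries of paths\<close>

lemma odd_card_sym_diff:
  assumes "finite A" "finite B"
  shows "odd (card (sym_diff A B)) \<longleftrightarrow> odd (card A) \<noteq> odd (card B)"
proof -
  have "card (sym_diff A B) = card (A - B) + card (B - A)"
    using assms by (intro card_Un_disjoint) auto
  moreover have "card A = card (A - B) + card (A \<inter> B)"
    using card_Diff_subset_Int[of A B] card_mono[of A "A \<inter> B"] assms by simp
  moreover have "card B = card (B - A) + card (A \<inter> B)"
    using card_Diff_subset_Int[of B A] card_mono[of B "B \<inter> A"] assms by (simp add: Int_commute)
  ultimately show ?thesis by auto
qed

text \<open>Rank-nullity over the field with two elements, as a count. The subsets of
  \<open>A\<close> and of \<open>B\<close> form vector spaces under \<open>sym_diff\<close>, and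
  \<open>d\<close> is linear. It attains every singleton, that is, the standard basis, so it is
  onto, and all \<open>2 ^ card B\<close> fibres are cosets of the kernel.\<close>

lemma card_kernel_sym_diff:
  assumes A: "finite A" and B: "finite B"
    and into: "\<And>S. S \<subseteq> A \<Longrightarrow> d S \<subseteq> B"
    and lin: "\<And>S T. S \<subseteq> A \<Longrightarrow> T \<subseteq> A \<Longrightarrow> d (sym_diff S T) = sym_diff (d S) (d T)"
    and gen: "\<And>x. x \<in> B \<Longrightarrow> \<exists>S\<subseteq>A. d S = {x}"
  shows "card {S. S \<subseteq> A \<and> d S = {}} * 2 ^ card B = 2 ^ card A"
proof -
  let ?K = "{S. S \<subseteq> A \<and> d S = {}}"
  have surj: "\<exists>S\<subseteq>A. d S = T" if "T \<subseteq> B" for T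
    using finite_subset[OF that B] that
  proof (induction T rule: finite_induct)
    case empty
    have "d {} = {}" using lin[of "{}" "{}"] by simp
    then show ?case by (intro exI[of _ "{}"]) simp
  next
    case (insert x T)
    obtain S where S: "S \<subseteq> A" "d S = T" using insert.IH insert.prems by auto
    obtain R where R: "R \<subseteq> A" "d R = {x}" using gen[of x] insert.prems by auto
    have "d (sym_diff R S) = insert x T"
      using lin[OF R(1) S(1)] R S insert.hyps by auto
    then show ?case using R S by (intro exI[of _ "sym_diff R S"]) auto
  qed
  have fibre: "card {S \<in> Pow A. d S = T} = card ?K" if T: "T \<in> Pow B" for T
  proof -
    obtain R where R: "R \<subseteq> A" "d R = T" using surj T by auto
    \<comment> \<open>Adding a fixed preimage \<open>R\<close> of \<open>T\<close> is its own
      inverse; it exchanges the fibre over \<open>T\<close> with the kernel.\<close>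
    have "bij_betw (sym_diff R) {S \<in> Pow A. d S = T} ?K"
      by (rule bij_betw_byWitness[where f' = "sym_diff R"]) (use R lin in auto)
    then show ?thesis by (rule bij_betw_same_card)
  qed
  have "(2::nat) ^ card A = (\<Sum>S\<in>Pow A. 1)"
    using A by (simp add: card_Pow)
  also have "\<dots> = (\<Sum>T\<in>Pow B. \<Sum>S\<in>{S \<in> Pow A. d S = T}. 1)"
    using A B into by (intro sum.group[symmetric]) auto
  also have "\<dots> = (\<Sum>T\<in>Pow B. card ?K)"
    by (intro sum.cong refl) (simp only: fibre flip: card_eq_sum)
  finally show ?thesis using B by (simp add: card_Pow mult.commute)
qed

text \<open>Adding an edge \<open>{y, z}\<close> modulo 2 moves the odd endpoint from
  \<open>y\<close> to \<open>z\<close>. Edges repeated along a walk cancel, so the walk need not be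
  simple. For \<open>a = b\<close> the right-hand side is false everywhere.\<close>

lemma path_boundary:
  assumes G: "simple_graph V E" and path: "(b, a) \<in> {(x, y). {x, y} \<in> E}\<^sup>*"
  shows "\<exists>P\<subseteq>E. \<forall>v. odd (card {e \<in> P. v \<in> e}) \<longleftrightarrow> (v = a) \<noteq> (v = b)"
  using path
proof (induction rule: rtrancl_induct)
  case base
  show ?case by (intro exI[of _ "{}"]) auto
next
  case (step y z)
  then obtain P where P: "P \<subseteq> E" "\<And>v. odd (card {e \<in> P. v \<in> e}) \<longleftrightarrow> (v = y) \<noteq> (v = b)"
    by blast
  have e: "{y, z} \<in> E" using step by simp
  have "card {y, z} = 2" using G e unfolding simple_graph_def by blast
  then have ne: "y \<noteq> z" by auto
  have finP: "finite P"
  proof (rule finite_subset)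
    show "P \<subseteq> Pow V" using P(1) G unfolding simple_graph_def by blast
    show "finite (Pow V)" using G unfolding simple_graph_def by simp
  qed
  have "odd (card {e \<in> sym_diff P {{y, z}}. v \<in> e}) \<longleftrightarrow> (v = z) \<noteq> (v = b)" for v
  proof -
    have split: "{e \<in> sym_diff P {{y, z}}. v \<in> e}
        = sym_diff {e \<in> P. v \<in> e} {e \<in> {{y, z}}. v \<in> e}" by auto
    moreover have "{e \<in> {{y, z}}. v \<in> e} = (if v = y \<or> v = z then {{y, z}} else {})" by auto
    ultimately show ?thesis
      using finP P(2)[of v] ne by (subst split, subst odd_card_sym_diff) auto
  qed
  then show ?case using P(1) e by (intro exI[of _ "sym_diff P {{y, z}}"]) auto
qed

text \<open>The swap exchanges \<open>{a} \<times> e\<close> and \<open>e \<times> {a}\<close>, so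
  \<open>S\<close> names each orbit of edges by its vertical member
  \<open>{a} \<times> e\<close>.\<close>

definition sym_edges :: "('a \<times> 'a set) set \<Rightarrow> ('a \<times> 'a) set set" where
  "sym_edges S = (\<lambda>(a, e). {a} \<times> e) ` S \<union> (\<lambda>(a, e). e \<times> {a}) ` S"

lemma sym_edges_iff: "x \<in> sym_edges S \<longleftrightarrow> (\<exists>a e. (a, e) \<in> S \<and> (x = {a} \<times> e \<or> x = e \<times> {a}))"
  unfolding sym_edges_def by fast

text \<open>This counts the vertical edges of \<open>sym_edges S\<close> at \<open>(a, b)\<close>.
  The horizontal ones, \<open>e \<times> {b}\<close> with \<open>a \<in> e\<close>, are counted by
  \<open>half_degree S b a\<close>.\<close>

definition half_degree :: "('a \<times> 'a set) set \<Rightarrow> 'a \<Rightarrow> 'a \<Rightarrow> nat" where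
  "half_degree S a b = card {e. (a, e) \<in> S \<and> b \<in> e}"

text \<open>The linear map whose kernel is counted. Unordered pairs suffice as indices because the
  sum is symmetric in \<open>a\<close> and \<open>b\<close>.\<close>

definition odd_pairs :: "'a set \<Rightarrow> ('a \<times> 'a set) set \<Rightarrow> 'a set set" where
  "odd_pairs V S =
     {p. p \<subseteq> V \<and> card p = 2 \<and> (\<exists>a b. p = {a, b} \<and> odd (half_degree S a b + half_degree S b a))}"

lemma doubleton_in_odd_pairs:
  assumes "a \<in> V" "b \<in> V" "a \<noteq> b"
  shows "{a, b} \<in> odd_pairs V S \<longleftrightarrow> odd (half_degree S a b + half_degree S b a)"
  using assms unfolding odd_pairs_def by (auto simp: doubleton_eq_iff)

section \<open>Symmetric edge sets of the square and their degrees\<close>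

context
  fixes V :: "'a set" and E :: "'a set set"
  assumes G: "simple_graph V E"
begin

lemma finite_edges: "finite E"
proof (rule finite_subset)
  show "E \<subseteq> Pow V" using G unfolding simple_graph_def by blast
  show "finite (Pow V)" using G unfolding simple_graph_def by simp
qed

lemma finite_verts: "finite V"
  using G unfolding simple_graph_def by blast

lemma edgeD: "e \<in> E \<Longrightarrow> e \<subseteq> V \<and> card e = 2"
  using G unfolding simple_graph_def by blast

lemma edge_nonempty: "e \<in> E \<Longrightarrow> e \<noteq> {}"
  using edgeD by force

lemma box_square_edges_eq: "box_square_edges V E = sym_edges (V \<times> E)"
proof -
  have pair: "\<exists>b c. e = {b, c}" if "e \<in> E" for e
    using edgeD[OF that] by (auto simp: card_2_iff)
  have times: "{a} \<times> {b, c} = {(a, b), (a, c)}" "{b, c} \<times> {a} = {(b, a), (c, a)}" for a b c :: 'a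
    by auto
  have "(\<lambda>(a, e). {a} \<times> e) ` (V \<times> E) = {{a} \<times> {b, c} | a b c. a \<in> V \<and> {b, c} \<in> E}"
    using pair by (fast intro: rev_image_eqI)
  moreover have "(\<lambda>(a, e). e \<times> {a}) ` (V \<times> E) = {{b, c} \<times> {a} | a b c. a \<in> V \<and> {b, c} \<in> E}"
    using pair by (fast intro: rev_image_eqI)
  ultimately show ?thesis unfolding box_square_edges_def sym_edges_def times by simp
qed

text \<open>The left side has two different second coordinates, the right side at most one. Hence
  the swap fixes no edge of the square.\<close>

lemma vertical_neq_horizontal:
  assumes "e \<in> E"
  shows "{a} \<times> e \<noteq> f \<times> {b}"
proof
  assume eq: "{a} \<times> e = f \<times> {b}"
  have "card e = 2" using edgeD assms by blast
  then obtain x y where "x \<in> e" "y \<in> e" "x \<noteq> y" by (auto simp: card_2_iff)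
  then have "(a, x) \<in> f \<times> {b}" "(a, y) \<in> f \<times> {b}" by (auto simp flip: eq)
  with \<open>x \<noteq> y\<close> show False by auto
qed

lemma vertical_in_sym_edges:
  assumes "e \<in> E"
  shows "{a} \<times> e \<in> sym_edges S \<longleftrightarrow> (a, e) \<in> S"
proof
  assume "{a} \<times> e \<in> sym_edges S"
  then obtain b f where bf: "(b, f) \<in> S" "{a} \<times> e = {b} \<times> f \<or> {a} \<times> e = f \<times> {b}"
    unfolding sym_edges_iff by metis
  then have "{a} \<times> e = {b} \<times> f"
    using vertical_neq_horizontal[OF assms, of a f b] by argo
  \<comment> \<open>If \<open>e\<close> were empty, the product would not determine
    \<open>a\<close>.\<close>
  then have "b = a" "f = e" using edge_nonempty[OF assms] by (auto simp: times_eq_iff)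
  with bf show "(a, e) \<in> S" by simp
next
  assume "(a, e) \<in> S"
  then show "{a} \<times> e \<in> sym_edges S" unfolding sym_edges_iff by blast
qed

lemma swap_image_times: "prod.swap ` (A \<times> B) = B \<times> A"
  by auto

text \<open>The inverse reads off the vertical edges of \<open>C\<close>; swap invariance then
  forces the horizontal ones.\<close>

lemma bij_betw_sym_edges:
  "bij_betw sym_edges (Pow (V \<times> E)) {C. C \<subseteq> box_square_edges V E \<and> swap_invariant C}"
proof (rule bij_betw_byWitness[where f' = "\<lambda>C. {(a, e) \<in> V \<times> E. {a} \<times> e \<in> C}"])
  show "\<forall>S\<in>Pow (V \<times> E). {(a, e) \<in> V \<times> E. {a} \<times> e \<in> sym_edges S} = S"
    using vertical_in_sym_edges by blast
  show "sym_edges ` Pow (V \<times> E) \<subseteq> {C. C \<subseteq> box_square_edges V E \<and> swap_invariant C}"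
  proof -
    have "swap_invariant (sym_edges S)" for S :: "('a \<times> 'a set) set"
      unfolding swap_invariant_def sym_edges_def image_Un image_image
      by (simp add: split_beta swap_image_times Un_commute)
    moreover have "sym_edges S \<subseteq> sym_edges (V \<times> E)" if "S \<subseteq> V \<times> E" for S
      using that unfolding sym_edges_def by (intro Un_mono image_mono)
    ultimately show ?thesis by (auto simp: box_square_edges_eq)
  qed
  show "(\<lambda>C. {(a, e) \<in> V \<times> E. {a} \<times> e \<in> C}) ` {C. C \<subseteq> box_square_edges V E \<and> swap_invariant C}
      \<subseteq> Pow (V \<times> E)" by auto
  show "\<forall>C\<in>{C. C \<subseteq> box_square_edges V E \<and> swap_invariant C}.
      sym_edges {(a, e) \<in> V \<times> E. {a} \<times> e \<in> C} = C"
  proof safe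
    fix C assume sub: "C \<subseteq> box_square_edges V E" and inv: "swap_invariant C"
    have sw: "B \<times> A \<in> C" if "A \<times> B \<in> C" for A B :: "'a set"
      using imageI[OF that, of "\<lambda>e. prod.swap ` e"] inv
      unfolding swap_invariant_def swap_image_times by simp
    fix x
    {
      assume "x \<in> sym_edges {(a, e) \<in> V \<times> E. {a} \<times> e \<in> C}"
      then show "x \<in> C" using sw unfolding sym_edges_iff by blast
    next
      assume x: "x \<in> C"
      then obtain a e where ae: "a \<in> V" "e \<in> E" "x = {a} \<times> e \<or> x = e \<times> {a}"
        using sub unfolding box_square_edges_eq subset_iff sym_edges_iff by blast
      then have "{a} \<times> e \<in> C" using x sw by blast
      with ae show "x \<in> sym_edges {(a, e) \<in> V \<times> E. {a} \<times> e \<in> C}"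
        unfolding sym_edges_iff by blast
    }
  qed
qed

lemma finite_half:
  assumes "S \<subseteq> V \<times> E"
  shows "finite {e. (a, e) \<in> S \<and> b \<in> e}"
  using finite_edges by (rule finite_subset[rotated]) (use assms in auto)

lemma degree_sym_edges:
  assumes S: "S \<subseteq> V \<times> E"
  shows "card {x \<in> sym_edges S. (a, b) \<in> x} = half_degree S a b + half_degree S b a"
proof -
  let ?A = "{e. (a, e) \<in> S \<and> b \<in> e}" and ?B = "{e. (b, e) \<in> S \<and> a \<in> e}"
  have "{x \<in> sym_edges S. (a, b) \<in> x} = (\<lambda>e. {a} \<times> e) ` ?A \<union> (\<lambda>e. e \<times> {b}) ` ?B"
    unfolding sym_edges_def by auto
  also have "card \<dots> = card ((\<lambda>e. {a} \<times> e) ` ?A) + card ((\<lambda>e. e \<times> {b}) ` ?B)"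
  proof (rule card_Un_disjoint)
    show "(\<lambda>e. {a} \<times> e) ` ?A \<inter> (\<lambda>e. e \<times> {b}) ` ?B = {}"
    proof (rule equals0I)
      fix x assume "x \<in> (\<lambda>e. {a} \<times> e) ` ?A \<inter> (\<lambda>e. e \<times> {b}) ` ?B"
      then obtain e f where "(a, e) \<in> S" "{a} \<times> e = f \<times> {b}" by fast
      moreover from this have "e \<in> E" using S by auto
      ultimately show False using vertical_neq_horizontal by metis
    qed
  qed (use finite_half[OF S] in auto)
  also have "\<dots> = card ?A + card ?B"
    by (subst (1 2) card_image) (auto simp: inj_on_def times_eq_iff)
  finally show ?thesis unfolding half_degree_def .
qed

lemma one_cycle_sym_edges_iff:
  assumes S: "S \<subseteq> V \<times> E"
  shows "one_cycle (box_square_verts V) (box_square_edges V E) (sym_edges S)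
      \<longleftrightarrow> odd_pairs V S = {}"
proof -
  have "sym_edges S \<subseteq> box_square_edges V E"
    using bij_betw_sym_edges S by (auto simp: bij_betw_def)
  then have "one_cycle (box_square_verts V) (box_square_edges V E) (sym_edges S)
      \<longleftrightarrow> (\<forall>a\<in>V. \<forall>b\<in>V. even (half_degree S a b + half_degree S b a))"
    unfolding one_cycle_def box_square_verts_def using degree_sym_edges[OF S] by auto
  \<comment> \<open>On the diagonal the two summands coincide, so the degree is even.\<close>
  also have "\<dots> \<longleftrightarrow> (\<forall>a\<in>V. \<forall>b\<in>V. a \<noteq> b \<longrightarrow> even (half_degree S a b + half_degree S b a))"
    by (metis even_add)
  also have "\<dots> \<longleftrightarrow> (\<forall>a\<in>V. \<forall>b\<in>V. a \<noteq> b \<longrightarrow> {a, b} \<notin> odd_pairs V S)"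
    by (simp add: doubleton_in_odd_pairs)
  also have "\<dots> \<longleftrightarrow> odd_pairs V S = {}"
  proof -
    have "\<exists>a\<in>V. \<exists>b\<in>V. a \<noteq> b \<and> p = {a, b}" if "p \<in> odd_pairs V S" for p
      using that unfolding odd_pairs_def card_2_iff by blast
    then show ?thesis by blast
  qed
  finally show ?thesis .
qed

section \<open>Linearity and independence of the parity conditions\<close>

lemma odd_half_degree_sym_diff:
  assumes "S \<subseteq> V \<times> E" "T \<subseteq> V \<times> E"
  shows "odd (half_degree (sym_diff S T) a b) \<longleftrightarrow> odd (half_degree S a b) \<noteq> odd (half_degree T a b)"
proof -
  have "{e. (a, e) \<in> sym_diff S T \<and> b \<in> e}
      = sym_diff {e. (a, e) \<in> S \<and> b \<in> e} {e. (a, e) \<in> T \<and> b \<in> e}" by auto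
  then show ?thesis
    unfolding half_degree_def
    using odd_card_sym_diff[OF finite_half[OF assms(1)] finite_half[OF assms(2)]] by simp
qed

lemma odd_pairs_sym_diff:
  assumes "S \<subseteq> V \<times> E" "T \<subseteq> V \<times> E"
  shows "odd_pairs V (sym_diff S T) = sym_diff (odd_pairs V S) (odd_pairs V T)"
proof (rule set_eqI)
  fix p
  show "p \<in> odd_pairs V (sym_diff S T) \<longleftrightarrow> p \<in> sym_diff (odd_pairs V S) (odd_pairs V T)"
  proof (cases "p \<subseteq> V \<and> card p = 2")
    case True
    then obtain a b where "p = {a, b}" "a \<in> V" "b \<in> V" "a \<noteq> b" by (auto simp: card_2_iff)
    then show ?thesis
      using odd_half_degree_sym_diff[OF assms] by (auto simp: doubleton_in_odd_pairs)
  qed (auto simp: odd_pairs_def)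
qed

lemma odd_pairs_singleton:
  assumes conn: "connected_graph V E" and p: "p \<subseteq> V" "card p = 2"
  shows "\<exists>S\<subseteq>V \<times> E. odd_pairs V S = {p}"
proof -
  obtain a b where ab: "p = {a, b}" "a \<in> V" "b \<in> V" "a \<noteq> b" using p by (auto simp: card_2_iff)
  have "(b, a) \<in> {(x, y). {x, y} \<in> E}\<^sup>*"
    using conn ab unfolding connected_graph_def by blast
  from path_boundary[OF G this] obtain P
    where P: "P \<subseteq> E" "\<And>v. odd (card {e \<in> P. v \<in> e}) \<longleftrightarrow> (v = a) \<noteq> (v = b)" by blast
  \<comment> \<open>Only row \<open>a\<close> contributes, and there the parity is the boundary of
    \<open>P\<close>. The odd positions are \<open>(a, a)\<close> and \<open>(a, b)\<close>; the
    former is diagonal, so only the pair \<open>{a, b}\<close> remains.\<close>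
  have hd: "odd (half_degree ({a} \<times> P) x y) \<longleftrightarrow> x = a \<and> (y = a \<or> y = b)" for x y
  proof (cases "x = a")
    case True
    then have "{e. (x, e) \<in> {a} \<times> P \<and> y \<in> e} = {e \<in> P. y \<in> e}" by auto
    then show ?thesis using P(2)[of y] ab True unfolding half_degree_def by auto
  qed (auto simp: half_degree_def)
  have "q \<in> odd_pairs V ({a} \<times> P) \<longleftrightarrow> q = p" for q
  proof (cases "q \<subseteq> V \<and> card q = 2")
    case True
    then obtain x y where "q = {x, y}" "x \<in> V" "y \<in> V" "x \<noteq> y" by (auto simp: card_2_iff)
    then show ?thesis
      using hd ab by (auto simp: doubleton_in_odd_pairs doubleton_eq_iff)
  qed (use p in \<open>auto simp: odd_pairs_def\<close>)
  then have "odd_pairs V ({a} \<times> P) = {p}" by blast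
  moreover have "{a} \<times> P \<subseteq> V \<times> E" using ab P by auto
  ultimately show ?thesis by blast
qed

end

theorem mainTheorem2:
  fixes V :: "'a set" and E :: "'a set set"
  assumes "simple_graph V E" and "connected_graph V E"
  shows "card {C. one_cycle (box_square_verts V) (box_square_edges V E) C \<and> swap_invariant C}
           = 2 ^ (card V * card E - (card V choose 2))"
proof -
  note G = assms(1)
  let ?K = "{S. S \<subseteq> V \<times> E \<and> odd_pairs V S = {}}"
  let ?C = "{C. one_cycle (box_square_verts V) (box_square_edges V E) C \<and> swap_invariant C}"
  let ?B = "{p. p \<subseteq> V \<and> card p = 2}"
  have image_K: "sym_edges ` ?K = ?C"
  proof -
    have "C \<in> sym_edges ` Pow (V \<times> E)" if "C \<in> ?C" for C
      using that bij_betw_sym_edges[OF G] unfolding bij_betw_def one_cycle_def by blast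
    moreover have "swap_invariant (sym_edges S)" if "S \<subseteq> V \<times> E" for S
      using that bij_betw_sym_edges[OF G] unfolding bij_betw_def by blast
    ultimately show ?thesis using one_cycle_sym_edges_iff[OF G] by blast
  qed
  have card_C: "card ?C = card ?K"
  proof -
    have "inj_on sym_edges ?K"
      using bij_betw_sym_edges[OF G] unfolding bij_betw_def by (blast intro: inj_on_subset)
    from card_image[OF this] show ?thesis unfolding image_K .
  qed
  have "card ?K * 2 ^ card ?B = 2 ^ card (V \<times> E)"
  proof (rule card_kernel_sym_diff)
    show "finite (V \<times> E)" using finite_verts[OF G] finite_edges[OF G] by simp
    show "finite ?B" using finite_verts[OF G] by simp
    show "odd_pairs V S \<subseteq> ?B" for S unfolding odd_pairs_def by auto
    show "odd_pairs V (sym_diff S T) = sym_diff (odd_pairs V S) (odd_pairs V T)"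
      if "S \<subseteq> V \<times> E" "T \<subseteq> V \<times> E" for S T
      using that by (rule odd_pairs_sym_diff[OF G])
    show "\<exists>S\<subseteq>V \<times> E. odd_pairs V S = {p}" if "p \<in> ?B" for p
      using that by (intro odd_pairs_singleton[OF G assms(2)]) auto
  qed
  then have eq: "card ?K * 2 ^ (card V choose 2) = (2::nat) ^ (card V * card E)"
    using n_subsets[OF finite_verts[OF G], of 2] by (simp add: card_cartesian_product)
  \<comment> \<open>The exponent in the goal is a truncated difference of naturals. The inequality
    that makes it a true difference follows from the count itself, by divisibility of powers of
    2.\<close>
  have "(2::nat) ^ (card V choose 2) dvd 2 ^ (card V * card E)"
    unfolding eq[symmetric] by (rule dvd_triv_right)
  then have "card V choose 2 \<le> card V * card E"
    by (simp add: dvd_power_iff_le)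
  then have "(2::nat) ^ (card V * card E)
      = 2 ^ (card V * card E - (card V choose 2)) * 2 ^ (card V choose 2)"
    by (simp flip: power_add)
  with eq card_C show ?thesis by simp
qed

end
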